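(* Let $\alpha\in(0,1)$ and let $\rho_{AB}$ be a state on $\mathbb{C}_A\otimes\mathbb{C}_B$. For a local measurement (POVM) $M_B$ on $B$, let $\rho_{AB'}=\sum_xp_x\rho_x^A\otimes|x\rangle\langle x|_{B'}$ be the post-measurement state and $\xi_{AB}^{M_B}=\{p_x,\rho_x^A\}$ the corresponding ensemble on $A$. Then $$C_\alpha(\rho_{AB})=\sup_{\xi_{AB}^{M_B}}Q_\alpha(\xi_{AB}^{M_B})=0$$ (the supremum being over all ensembles created by local measurements on $B$) if and only if $\rho_{AB}$ is a product state, i.e. $\rho_{AB}=\rho_A\otimes\rho_B$.
   Context: All Hilbert spaces are finite-dimensional complex Hilbert spaces. A state is a positive semidefinite operator of trace one; $\rho_A=\mathrm{Tr}_B\rho_{AB}$, $\rho_B=\mathrm{Tr}_A\rho_{AB}$. Quantum $\alpha$-Rényi entropy: $S_\alpha(\rho)=\frac{1}{1-\alpha}\log\mathrm{Tr}(\rho^\alpha)$. $\alpha$-quantum Jensen-Shannon divergence of an ensemble $\xi=\{p_k,\rho_k\}_k$ of states: $Q_\alpha(\xi)=S_\alpha\big(\sum_k p_k\rho_k\big)-\sum_k p_kS_\alpha(\rho_k)$. For a POVM $M_B=\{M_x\}_x$ on $B$ (finitely many positive semidefinite operators summing to the identity), the ensemble is $\xi_{AB}^{M_B}=\{p_x,\rho_x^A\}_x$, where $p_x\rho_x^A=\mathrm{Tr}_B\big((\mathbb{I}_A\otimes M_x)\rho_{AB}\big)$ and $p_x$ is the trace of this operator (terms with $p_x=0$ are dropped);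 $\{|x\rangle\}$ is an orthonormal basis of the classical register $B'$. *)

theory Defs
  imports "HOL-Analysis.Analysis"
begin

text \<open>
  Operators on the Hilbert space with orthonormal basis indexed by the finite type \<open>'n\<close> are
  matrices \<open>complex^'n^'n\<close>; the tensor product of the spaces indexed by \<open>'a\<close> and \<open>'b\<close> is
  indexed by \<open>'a \<times> 'b\<close>.
\<close>

definition dagger :: "complex^'n^'m \<Rightarrow> complex^'m^'n" where
  "dagger A = (\<chi> i j. cnj (A $ j $ i))"

definition unitary :: "complex^'n^'n \<Rightarrow> bool" where
  "unitary U \<longleftrightarrow> dagger U ** U = mat 1 \<and> U ** dagger U = mat 1"

definition diag :: "('n \<Rightarrow> complex) \<Rightarrow> complex^'n^'n" where
  "diag d = (\<chi> i j. if i = j then d i else 0)"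

definition psd :: "complex^'n^'n \<Rightarrow> bool" where
  "psd A \<longleftrightarrow> (\<forall>v. (\<Sum>i\<in>UNIV. cnj (v $ i) * (A *v v) $ i) \<in> \<real>\<^sub>\<ge>\<^sub>0)"

definition state :: "complex^'n^'n \<Rightarrow> bool" where
  "state \<rho> \<longleftrightarrow> psd \<rho> \<and> trace \<rho> = 1"

definition tensor ::
  "complex^'a^'a \<Rightarrow> complex^'b^'b \<Rightarrow> complex^('a \<times> 'b)^('a \<times> 'b)" where
  "tensor A B = (\<chi> i j. A $ fst i $ fst j * B $ snd i $ snd j)"

definition ptrace_A :: "complex^('a::finite \<times> 'b)^('a \<times> 'b) \<Rightarrow> complex^'b^'b" where
  "ptrace_A \<rho> = (\<chi> k l. \<Sum>i\<in>UNIV. \<rho> $ (i, k) $ (i, l))"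

definition ptrace_B :: "complex^('a \<times> 'b::finite)^('a \<times> 'b) \<Rightarrow> complex^'a^'a" where
  "ptrace_B \<rho> = (\<chi> i j. \<Sum>k\<in>UNIV. \<rho> $ (i, k) $ (j, k))"

text \<open>
  Functional calculus \<open>A \<mapsto> A\<^sup>\<alpha>\<close> for positive semidefinite \<open>A\<close>: the spectral theorem gives a
  diagonalisation, and the result does not depend on which one is taken. Since \<open>0 powr \<alpha> = 0\<close>,
  the kernel of \<open>A\<close> contributes nothing.
\<close>

definition op_powr :: "complex^'n^'n \<Rightarrow> real \<Rightarrow> complex^'n^'n" where
  "op_powr A \<alpha> = (THE B. \<exists>U (d :: 'n \<Rightarrow> real). unitary U \<and>
      A = U ** diag (\<lambda>i. of_real (d i)) ** dagger U \<and>
      B = U ** diag (\<lambda>i. of_real (d i powr \<alpha>)) ** dagger U)"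

text \<open>The trace below is real for positive semidefinite \<open>\<rho>\<close>. The logarithm is natural.\<close>

definition renyi_entropy :: "real \<Rightarrow> complex^'n^'n \<Rightarrow> real" where
  "renyi_entropy \<alpha> \<rho> = 1 / (1 - \<alpha>) * ln (Re (trace (op_powr \<rho> \<alpha>)))"

text \<open>An ensemble is given by a finite index set \<open>K\<close>, probabilities \<open>p\<close> and states \<open>\<rho>\<close>.\<close>

definition qjsd ::
  "real \<Rightarrow> 'k set \<Rightarrow> ('k \<Rightarrow> real) \<Rightarrow> ('k \<Rightarrow> complex^'n^'n) \<Rightarrow> real" where
  "qjsd \<alpha> K p \<rho> =
     renyi_entropy \<alpha> (\<Sum>k\<in>K. p k *\<^sub>R \<rho> k) - (\<Sum>k\<in>K. p k * renyi_entropy \<alpha> (\<rho> k))"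

definition povm :: "nat \<Rightarrow> (nat \<Rightarrow> complex^'n^'n) \<Rightarrow> bool" where
  "povm n M \<longleftrightarrow> (\<forall>x<n. psd (M x)) \<and> (\<Sum>x<n. M x) = mat 1"

definition unnormalised_post ::
  "complex^('a \<times> 'b::finite)^('a::finite \<times> 'b) \<Rightarrow> complex^'b^'b \<Rightarrow> complex^'a^'a" where
  "unnormalised_post \<rho> E = ptrace_B (tensor (mat 1) E ** \<rho>)"

definition outcome_prob ::
  "complex^('a \<times> 'b::finite)^('a::finite \<times> 'b) \<Rightarrow> complex^'b^'b \<Rightarrow> real" where
  "outcome_prob \<rho> E = Re (trace (unnormalised_post \<rho> E))"

definition post_state ::
  "complex^('a \<times> 'b::finite)^('a::finite \<times> 'b) \<Rightarrow> complex^'b^'b \<Rightarrow> complex^'a^'a" where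
  "post_state \<rho> E = (1 / outcome_prob \<rho> E) *\<^sub>R unnormalised_post \<rho> E"

definition measured_qjsd ::
  "real \<Rightarrow> complex^('a \<times> 'b::finite)^('a::finite \<times> 'b) \<Rightarrow> nat \<Rightarrow> (nat \<Rightarrow> complex^'b^'b) \<Rightarrow> real" where
  "measured_qjsd \<alpha> \<rho> n M =
     qjsd \<alpha> {x. x < n \<and> outcome_prob \<rho> (M x) \<noteq> 0}
       (\<lambda>x. outcome_prob \<rho> (M x)) (\<lambda>x. post_state \<rho> (M x))"

text \<open>
  The supremum is taken in \<open>ereal\<close>, where it exists without a separate boundedness argument.
\<close>

definition correlation ::
  "real \<Rightarrow> complex^('a::finite \<times> 'b::finite)^('a \<times> 'b) \<Rightarrow> ereal" where
  "correlation \<alpha> \<rho> = Sup {ereal (measured_qjsd \<alpha> \<rho> n M) | n M. povm n M}"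

end

theory Submission
  imports Defs
begin

text \<open>
  For \<open>0 < \<alpha> < 1\<close> the function \<open>x powr \<alpha>\<close> is strictly concave. Applying Jensen's inequality in an
  eigenbasis of \<open>\<tau> = \<Sum>k. p k *\<^sub>R \<sigma> k\<close>, with weights the \<open>p k\<close> times the squared moduli of the overlaps
  with an eigenbasis of \<open>\<sigma> k\<close>, shows that \<open>\<Sum>k. p k Tr (\<sigma> k)\<^sup>\<alpha> \<le> Tr \<tau>\<^sup>\<alpha>\<close>, with equality only
  if every eigenvector of \<open>\<tau>\<close> is an eigenvector of all \<open>\<sigma> k\<close> for the same eigenvalue, i.e. only if
  all \<open>\<sigma> k\<close> coincide. Since \<open>ln\<close> is increasing and concave, an ensemble with \<open>Q\<^sub>\<alpha> \<le> 0\<close> is constant.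

  Hence, if the supremum vanishes, every effect \<open>E\<close> on \<open>B\<close> leaves the state on \<open>A\<close> unchanged (any
  positive \<open>E\<close> is, up to scaling, part of a two-outcome POVM). For rank-one \<open>E\<close> this says that, for
  fixed \<open>i\<close> and \<open>j\<close>, the quadratic form on \<open>B\<close> with matrix
  \<open>\<rho> $ (i, l) $ (j, k) - \<rho>\<^sub>A $ i $ j * \<rho>\<^sub>B $ l $ k\<close> vanishes, so the matrix itself vanishes by
  polarisation.
\<close>

section \<open>Complex inner product, adjoint and polarisation\<close>

definition cip :: "complex^'n \<Rightarrow> complex^'n \<Rightarrow> complex" where
  "cip v w = (\<Sum>i\<in>UNIV. cnj (v $ i) * w $ i)"

lemma cip_add_right: "cip v (w + x) = cip v w + cip v x"
  and cip_diff_right: "cip v (w - x) = cip v w - cip v x"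
  and cip_mult_right: "cip v (c *s w) = c * cip v w"
  and cip_scaleR_right: "cip v (r *\<^sub>R w) = r *\<^sub>R cip v w"
  by (simp_all add: cip_def algebra_simps sum.distrib sum_subtractf sum_distrib_left scaleR_sum_right)

lemma cip_add_left: "cip (v + w) x = cip v x + cip w x"
  and cip_mult_left: "cip (c *s v) x = cnj c * cip v x"
  by (simp_all add: cip_def algebra_simps sum.distrib sum_distrib_left)

lemma cnj_cip: "cnj (cip v w) = cip w v"
  by (simp add: cip_def mult.commute)

text \<open>This link to the real inner product makes real dimension counts and compactness
  arguments available for \<open>cip\<close>.\<close>

lemma Re_cip: "Re (cip v w) = v \<bullet> w" for v w :: "complex^'n"
  by (simp add: cip_def inner_vec_def inner_complex_def)

lemma cip_self: "cip v v = of_real ((norm v)\<^sup>2)" for v :: "complex^'n"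
proof -
  have "Im (cip v v) = 0" by (simp add: cip_def mult.commute)
  then show ?thesis
    by (simp add: complex_eq_iff Re_cip power2_norm_eq_inner)
qed

lemma dagger_nth [simp]: "dagger A $ i $ j = cnj (A $ j $ i)"
  by (simp add: dagger_def)

lemma diag_nth [simp]: "diag d $ i $ j = (if i = j then d i else 0)"
  by (simp add: diag_def)

lemma dagger_dagger [simp]: "dagger (dagger A) = A"
  by (simp add: vec_eq_iff)

lemma dagger_mult: "dagger (A ** B) = dagger B ** dagger A"
  by (simp add: vec_eq_iff matrix_matrix_mult_def mult.commute)

lemma cip_adjoint: "cip v (A *v w) = cip (dagger A *v v) w" for A :: "complex^'n^'m"
  unfolding cip_def matrix_vector_mult_def
  by (simp add: sum_distrib_left sum_distrib_right mult_ac) (rule sum.swap)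

lemma psd_cip: "psd A \<longleftrightarrow> (\<forall>v. cip v (A *v v) \<in> \<real>\<^sub>\<ge>\<^sub>0)"
  by (simp add: psd_def cip_def)

lemma cip_axis_left [simp]: "cip (axis i 1) v = v $ i"
  by (simp add: cip_def axis_def if_distrib[of cnj] if_distrib[of "\<lambda>x. x * _"] cong: if_cong)

lemma matrix_axis_nth [simp]: "(A *v axis j 1) $ i = A $ i $ j" for A :: "complex^'n^'m"
  by (simp add: matrix_vector_mult_def axis_def if_distrib[of "\<lambda>x. _ * x"] cong: if_cong)

text \<open>Polarisation: at \<open>v + c *s w\<close> only the two cross terms survive. Taking
  \<open>c = 1\<close> shows that their sum vanishes and \<open>c = \<i>\<close> that their
  difference does, so each is zero.\<close>

lemma zero_quadratic_form:
  fixes A :: "complex^'n^'n"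
  assumes "\<And>v. cip v (A *v v) = 0"
  shows "A = 0"
proof -
  have "cip v (A *v w) = 0" for v w
  proof -
    have *: "c * cip v (A *v w) + cnj c * cip w (A *v v) = 0" for c
      using assms[of "v + c *s w"] assms[of v] assms[of w]
      by (simp add: matrix_vector_right_distrib vector_scalar_commute
          cip_add_left cip_add_right cip_mult_left cip_mult_right add.commute)
    from *[of 1] *[of \<i>] show ?thesis
      by (simp add: add_eq_0_iff algebra_simps)
  qed
  from this[of "axis i 1" "axis j 1" for i j] show ?thesis
    by (simp add: vec_eq_iff)
qed

text \<open>A real quadratic form equals its conjugate, which is the quadratic form of the adjoint.
  Polarisation then identifies the two matrices.\<close>

lemma psd_hermitian:
  assumes "psd A"
  shows "dagger A = A"
proof -
  have "cip v ((A - dagger A) *v v) = 0" for v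
  proof -
    have "cip v (A *v v) \<in> \<real>"
      using assms nonneg_Reals_subset_Reals by (auto simp: psd_cip)
    then have "cnj (cip v (A *v v)) = cip v (A *v v)"
      by (simp add: Reals_cnj_iff)
    moreover have "cip v (dagger A *v v) = cnj (cip v (A *v v))"
      by (simp add: cip_adjoint cnj_cip)
    ultimately show ?thesis
      by (simp add: matrix_vector_mult_diff_rdistrib cip_diff_right)
  qed
  then show ?thesis
    using zero_quadratic_form by fastforce
qed

subsection \<open>The spectral theorem\<close>

text \<open>A real dimension count: complex orthogonality to \<open>u i\<close> amounts to real
  orthogonality to both \<open>u i\<close> and \<open>\<i> *s u i\<close>. A proper subset
  \<open>S\<close> thus imposes fewer than \<open>2 * CARD('n)\<close> real conditions, and that
  number is the real dimension.\<close>

lemma exists_orthogonal: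
  fixes u :: "'n::finite \<Rightarrow> complex^'n"
  assumes "S \<noteq> UNIV"
  obtains v where "v \<noteq> 0" "\<And>i. i \<in> S \<Longrightarrow> cip (u i) v = 0"
proof -
  define T where "T = u ` S \<union> (\<lambda>i. \<i> *s u i) ` S"
  have "card T \<le> card (u ` S) + card ((\<lambda>i. \<i> *s u i) ` S)"
    unfolding T_def by (rule card_Un_le)
  also have "\<dots> \<le> card S + card S"
    by (intro add_mono card_image_le) auto
  also have "\<dots> < 2 * CARD('n)"
    using assms psubset_card_mono[OF finite, of S UNIV] by (simp add: psubset_eq)
  also have "\<dots> = DIM(complex^'n)" by simp
  finally have "card T < DIM(complex^'n)" .
  moreover have "dim (span T) \<le> card T"
    by (simp add: T_def dim_le_card')
  ultimately have "dim (span T) < DIM(complex^'n)" by simp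
  then obtain v where v: "v \<noteq> 0" "\<And>y. y \<in> span T \<Longrightarrow> orthogonal v y"
    by (metis dim_span orthogonal_to_subspace_exists)
  have "cip (u i) v = 0" if "i \<in> S" for i
  proof -
    have "v \<bullet> u i = 0" "v \<bullet> (\<i> *s u i) = 0"
      using v(2)[OF span_base] that by (auto simp: T_def orthogonal_def)
    then have "Re (cip (u i) v) = 0" "Re (cip (\<i> *s u i) v) = 0"
      by (simp_all add: Re_cip inner_commute)
    then show ?thesis by (simp add: cip_mult_left complex_eq_iff)
  qed
  with v(1) that show thesis by blast
qed

text \<open>The Rayleigh quotient is maximised over the unit sphere of the orthogonal complement
  \<open>V\<close> of the eigenvectors found so far. As \<open>A\<close> maps \<open>V\<close> into
  itself, the residual \<open>r\<close> at the maximiser lies in \<open>V\<close>, and a nonzero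
  residual would be a direction of increase.\<close>

lemma hermitian_eigenvector:
  fixes A :: "complex^'n^'n" and u :: "'n \<Rightarrow> complex^'n"
  assumes A: "dagger A = A" and "S \<noteq> UNIV"
    and eig: "\<And>i. i \<in> S \<Longrightarrow> A *v u i = of_real (d i) *s u i"
  obtains v r where "norm v = 1" "A *v v = of_real r *s v" "\<And>i. i \<in> S \<Longrightarrow> cip (u i) v = 0"
proof -
  define V where "V = {v. \<forall>i\<in>S. cip (u i) v = 0}"
  define K where "K = V \<inter> sphere 0 1"
  define q where "q v = v \<bullet> (A *v v)" for v
  have V_lin: "v + t *\<^sub>R w \<in> V" "t *\<^sub>R w \<in> V" if "v \<in> V" "w \<in> V" for v w t
    using that by (simp_all add: V_def cip_add_right cip_scaleR_right)
  have A_lin: "A *v (v + t *\<^sub>R w) = A *v v + t *\<^sub>R (A *v w)" for v w t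
    by (simp add: vec_eq_iff matrix_vector_mult_def scaleR_sum_right sum.distrib distrib_left)
  have A_lin': "A *v (t *\<^sub>R w) = t *\<^sub>R (A *v w)" for w t
    using A_lin[of 0 t w] by simp
  have A_sym: "(A *v v) \<bullet> w = v \<bullet> (A *v w)" for v w
    using cip_adjoint[of v A w] A by (simp flip: Re_cip)
  have contA: "continuous_on T (\<lambda>v. A *v v)" for T
    unfolding matrix_vector_mult_def by (intro continuous_intros)
  have "closed V"
  proof -
    have "V = (\<Inter>i\<in>S. {v. cip (u i) v = 0})" by (auto simp: V_def)
    moreover have "closed {v. cip (u i) v = 0}" for i
      unfolding cip_def by (intro closed_Collect_eq continuous_intros)
    ultimately show ?thesis by auto
  qed
  then have "compact K"
    by (simp add: K_def closed_Int_compact)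
  moreover have "K \<noteq> {}"
  proof -
    obtain v where v: "v \<noteq> 0" "\<And>i. i \<in> S \<Longrightarrow> cip (u i) v = 0"
      using exists_orthogonal[OF \<open>S \<noteq> UNIV\<close>] by metis
    then have "(1 / norm v) *\<^sub>R v \<in> K"
      by (simp add: K_def V_def cip_scaleR_right)
    then show ?thesis by blast
  qed
  moreover have "continuous_on K q"
    unfolding q_def by (intro continuous_intros contA)
  ultimately obtain v where v: "v \<in> K" and max: "\<And>w. w \<in> K \<Longrightarrow> q w \<le> q v"
    by (metis continuous_attains_sup)
  txt \<open>\<open>Q \<ge> 0\<close> on \<open>V\<close> and \<open>Q v = 0\<close>, so \<open>Q\<close> has no first-order decrease at \<open>v\<close> along \<open>r\<close>.\<close>
  define Q where "Q w = q v * (w \<bullet> w) - q w" for w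
  define r where "r = A *v v - q v *\<^sub>R v"
  have Q_nonneg: "0 \<le> Q w" if "w \<in> V" for w
  proof (cases "w = 0")
    case False
    have "(1 / norm w) *\<^sub>R w \<in> K"
      using that False V_lin by (simp add: K_def)
    from max[OF this] have "q w / (norm w)\<^sup>2 \<le> q v"
      by (simp add: q_def A_lin' power2_eq_square)
    then show ?thesis
      using False by (simp add: Q_def power2_norm_eq_inner divide_simps split: if_splits)
  qed (simp add: Q_def q_def)
  have vV: "v \<in> V" and nv: "norm v = 1"
    using v by (auto simp: K_def)
  have rV: "r \<in> V"
  proof -
    have "cip (u i) (A *v v) = 0" if "i \<in> S" for i
      using that vV by (simp add: cip_adjoint A eig cip_mult_left V_def)
    then show ?thesis
      using vV by (simp add: V_def r_def cip_diff_right cip_scaleR_right)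
  qed
  have expand: "Q (v + t *\<^sub>R r) = t\<^sup>2 * Q r - 2 * t * (r \<bullet> r)" for t
  proof -
    have "v \<bullet> v = 1" using nv by (simp add: norm_eq_1)
    have 1: "v \<bullet> (A *v r) = (A *v v) \<bullet> r" using A_sym by simp
    have 2: "r \<bullet> r = (A *v v) \<bullet> r - q v * (v \<bullet> r)"
      by (subst (1) r_def) (simp add: inner_diff_left)
    have "Q (v + t *\<^sub>R r) =
        q v * (1 + 2 * t * (v \<bullet> r) + t\<^sup>2 * (r \<bullet> r)) - (q v + 2 * t * ((A *v v) \<bullet> r) + t\<^sup>2 * q r)"
      using \<open>v \<bullet> v = 1\<close> 1 unfolding Q_def
      by (simp add: q_def A_lin A_lin' inner_add_left inner_add_right inner_commute
          power2_eq_square algebra_simps)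
    then show ?thesis unfolding 2 by (simp add: Q_def algebra_simps 2)
  qed
  have "r = 0"
  proof (rule ccontr)
    assume "r \<noteq> 0"
    then have pos: "r \<bullet> r > 0" by simp
    have Qr: "0 \<le> Q r" using Q_nonneg rV by blast
    \<comment> \<open>For small \<open>t\<close> the linear term in \<open>expand\<close> outweighs
      the quadratic one; this value is small enough, and the \<open>+ 1\<close> keeps the
      denominator positive when \<open>Q r = 0\<close>.\<close>
    define t where "t = (r \<bullet> r) / (Q r + 1)"
    have "t > 0" using pos Qr by (simp add: t_def)
    have "0 \<le> t\<^sup>2 * Q r - 2 * t * (r \<bullet> r)"
      using Q_nonneg[OF V_lin(1)[OF vV rV, of t]] expand by simp
    then have "0 \<le> t * (t * Q r - 2 * (r \<bullet> r))"
      by (simp add: power2_eq_square algebra_simps)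
    then have "2 * (r \<bullet> r) \<le> t * Q r"
      using \<open>t > 0\<close> by (simp add: zero_le_mult_iff)
    also have "\<dots> \<le> t * (Q r + 1)" using \<open>t > 0\<close> by simp
    also have "\<dots> = r \<bullet> r" using Qr by (simp add: t_def)
    finally show False using pos by simp
  qed
  then have eigen: "A *v v = of_real (q v) *s v"
    by (simp add: r_def vec_eq_iff scaleR_conv_of_real[where 'a = complex])
  then show thesis
    using that[OF nv eigen] vV by (simp add: V_def)
qed

text \<open>Induction on the set of indices already served, adding one orthogonal eigenvector at a
  time. Indexing by \<open>'n\<close> itself lets the case \<open>S = UNIV\<close> be read as the
  columns of a square matrix.\<close>

lemma hermitian_eigenbasis:
  fixes A :: "complex^'n^'n"
  assumes "dagger A = A"
  shows "\<exists>(u :: 'n \<Rightarrow> complex^'n) d. (\<forall>i\<in>S. A *v u i = of_real (d i) *s u i) \<and>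
     (\<forall>i\<in>S. \<forall>j\<in>S. cip (u i) (u j) = (if i = j then 1 else 0))"
  using finite[of S]
proof induction
  case (insert k S)
  then obtain u d where eig: "\<And>i. i \<in> S \<Longrightarrow> A *v u i = of_real (d i) *s u i"
    and on: "\<And>i j. i \<in> S \<Longrightarrow> j \<in> S \<Longrightarrow> cip (u i) (u j) = (if i = j then 1 else 0)"
    by blast
  have "S \<noteq> UNIV" using insert by auto
  then obtain v r where v: "norm v = 1" "A *v v = of_real r *s v"
    "\<And>i. i \<in> S \<Longrightarrow> cip (u i) v = 0"
    using hermitian_eigenvector[OF assms \<open>S \<noteq> UNIV\<close>, of u d] eig by metis
  moreover have "cip v (u i) = 0" if "i \<in> S" for i
    using v(3)[OF that] cnj_cip[of "u i" v] by simp
  moreover have "cip v v = 1" using v(1) by (simp add: cip_self)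
  ultimately show ?case
    using eig on insert by (intro exI[of _ "u(k := v)"] exI[of _ "d(k := r)"]) auto
qed simp

theorem hermitian_diagonalisation:
  fixes A :: "complex^'n^'n"
  assumes "dagger A = A"
  obtains U and d :: "'n \<Rightarrow> real"
  where "unitary U" "A = U ** diag (\<lambda>i. of_real (d i)) ** dagger U"
proof -
  obtain u :: "'n \<Rightarrow> complex^'n" and d :: "'n \<Rightarrow> real"
    where eig: "\<And>i. A *v u i = of_real (d i) *s u i"
    and on: "\<And>i j. cip (u i) (u j) = (if i = j then 1 else 0)"
    using hermitian_eigenbasis[OF assms, of UNIV] by auto
  define U :: "complex^'n^'n" where "U = (\<chi> i j. u j $ i)"
  have 1: "dagger U ** U = mat 1"
    using on by (simp add: vec_eq_iff matrix_matrix_mult_def U_def mat_def cip_def)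
  then have 2: "U ** dagger U = mat 1"
    by (simp add: matrix_left_right_inverse)
  have "A ** U = U ** diag (\<lambda>i. of_real (d i))"
  proof -
    have "(A ** U) $ i $ j = (A *v u j) $ i" for i j
      by (simp add: matrix_matrix_mult_def matrix_vector_mult_def U_def)
    then show ?thesis
      by (simp add: vec_eq_iff eig matrix_matrix_mult_def U_def if_distrib[of "\<lambda>x. _ * x"] mult.commute
          cong: if_cong)
  qed
  then have "A = U ** diag (\<lambda>i. of_real (d i)) ** dagger U"
    by (metis 2 matrix_mul_assoc matrix_mul_rid)
  with 1 2 that show thesis by (auto simp: unitary_def)
qed

section \<open>Functional calculus, trace and positivity in an eigenbasis\<close>

lemma unitary_dagger_mult:
  assumes "unitary U"
  shows "dagger U ** U = mat 1" "U ** dagger U = mat 1"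
    "dagger U ** (U ** A) = A" "U ** (dagger U ** A) = A"
  using assms by (auto simp: unitary_def matrix_mul_assoc)

lemma unitary_cancel_right:
  assumes "unitary U"
  shows "A ** U ** dagger U = A" "A ** dagger U ** U = A"
  using assms by (auto simp: unitary_def simp flip: matrix_mul_assoc)

lemma diag_mult_nth [simp]: "(diag d ** A) $ i $ j = d i * A $ i $ j"
  by (simp add: matrix_matrix_mult_def if_distrib[of "\<lambda>x. x * _"] cong: if_cong)

lemma mult_diag_nth [simp]: "(A ** diag d) $ i $ j = A $ i $ j * d j"
  by (simp add: matrix_matrix_mult_def if_distrib[of "\<lambda>x. _ * x"] cong: if_cong)

lemma diag_mult_vec_nth [simp]: "(diag d *v v) $ i = d i * v $ i" for v :: "complex^'n"
  by (simp add: matrix_vector_mult_def if_distrib[of "\<lambda>x. x * _"] cong: if_cong)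

text \<open>With \<open>W = dagger V ** U\<close> the equation becomes
  \<open>W ** diag d = diag e ** W\<close>, which is read off entrywise. The criterion serves twice:
  it makes \<open>op_powr\<close> well defined, and it turns the equality case of Jensen's
  inequality into an equality of operators.\<close>

lemma diagonalisation_eq_iff:
  assumes "unitary U" "unitary V"
  shows "U ** diag d ** dagger U = V ** diag e ** dagger V \<longleftrightarrow>
    (\<forall>i j. (dagger V ** U) $ i $ j \<noteq> 0 \<longrightarrow> d j = e i)"
    (is "?A = ?B \<longleftrightarrow> ?R")
proof -
  have "?A = ?B \<longleftrightarrow> dagger V ** ?A ** U = dagger V ** ?B ** U"
  proof
    assume "dagger V ** ?A ** U = dagger V ** ?B ** U"
    then have "V ** (dagger V ** ?A ** U) ** dagger U = V ** (dagger V ** ?B ** U) ** dagger U"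
      by simp
    then show "?A = ?B"
      by (simp add: matrix_mul_assoc[symmetric] unitary_dagger_mult[OF assms(1)]
          unitary_dagger_mult[OF assms(2)])
  qed simp
  also have "\<dots> \<longleftrightarrow> dagger V ** U ** diag d = diag e ** (dagger V ** U)"
    by (simp add: matrix_mul_assoc[symmetric] unitary_dagger_mult[OF assms(1)]
        unitary_dagger_mult[OF assms(2)])
  also have "\<dots> \<longleftrightarrow> ?R"
    by (auto simp: vec_eq_iff)
  finally show ?thesis .
qed

text \<open>If \<open>d j = e i\<close> wherever the eigenbases overlap, the same holds for the
  powers. Hence all diagonalisations of \<open>A\<close> yield the same operator and the description
  in \<open>op_powr\<close> is unique.\<close>

lemma op_powr_diagonalised:
  assumes U: "unitary U" and A: "A = U ** diag (\<lambda>i. of_real (d i)) ** dagger U"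
  shows "op_powr A \<alpha> = U ** diag (\<lambda>i. of_real (d i powr \<alpha>)) ** dagger U"
  unfolding op_powr_def
proof (rule the_equality)
  fix B assume "\<exists>V (e :: 'a \<Rightarrow> real). unitary V \<and>
      A = V ** diag (\<lambda>i. of_real (e i)) ** dagger V \<and>
      B = V ** diag (\<lambda>i. of_real (e i powr \<alpha>)) ** dagger V"
  then obtain V and e :: "'a \<Rightarrow> real" where V: "unitary V"
    "A = V ** diag (\<lambda>i. of_real (e i)) ** dagger V"
    "B = V ** diag (\<lambda>i. of_real (e i powr \<alpha>)) ** dagger V"
    by blast
  have "V ** diag (\<lambda>i. of_real (e i)) ** dagger V = U ** diag (\<lambda>i. of_real (d i)) ** dagger U"
    using V A by simp
  then have "V ** diag (\<lambda>i. of_real (e i powr \<alpha>)) ** dagger V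
      = U ** diag (\<lambda>i. of_real (d i powr \<alpha>)) ** dagger U"
    unfolding diagonalisation_eq_iff[OF V(1) U] by auto
  then show "B = U ** diag (\<lambda>i. of_real (d i powr \<alpha>)) ** dagger U"
    using V by simp
qed (use assms in blast)

lemma trace_diagonalised:
  assumes "unitary U"
  shows "trace (U ** diag d ** dagger U) = (\<Sum>i\<in>UNIV. d i)"
proof -
  have "trace (U ** diag d ** dagger U) = trace (dagger U ** (U ** diag d))"
    by (rule trace_mul_sym)
  also have "\<dots> = trace (diag d)"
    by (simp add: unitary_dagger_mult[OF assms])
  finally show ?thesis by (simp add: trace_def)
qed

lemma trace_op_powr:
  assumes "unitary U" "A = U ** diag (\<lambda>i. of_real (d i)) ** dagger U"
  shows "Re (trace (op_powr A \<alpha>)) = (\<Sum>i\<in>UNIV. d i powr \<alpha>)"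
  unfolding op_powr_diagonalised[OF assms] trace_diagonalised[OF assms(1)] by simp

lemma cip_diagonalised:
  "cip v ((U ** diag (\<lambda>i. of_real (d i)) ** dagger U) *v v) =
    of_real (\<Sum>i\<in>UNIV. d i * (cmod ((dagger U *v v) $ i))\<^sup>2)"
proof -
  have "cip v ((U ** diag (\<lambda>i. of_real (d i)) ** dagger U) *v v) =
      cip (dagger U *v v) (diag (\<lambda>i. of_real (d i)) *v (dagger U *v v))"
    by (simp add: cip_adjoint matrix_vector_mul_assoc[symmetric])
  also have "\<dots> = of_real (\<Sum>i\<in>UNIV. d i * (cmod ((dagger U *v v) $ i))\<^sup>2)"
    unfolding cip_def of_real_sum of_real_mult complex_norm_square
    by (intro sum.cong refl) simp
  finally show ?thesis .
qed

lemma psd_diagonalised: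
  assumes "\<And>i. 0 \<le> d i"
  shows "psd (U ** diag (\<lambda>i. of_real (d i)) ** dagger U)"
  unfolding psd_cip cip_diagonalised using assms
  by (auto simp: complex_nonneg_Reals_iff intro!: sum_nonneg)

lemma psd_diagonalisation:
  fixes A :: "complex^'n^'n"
  assumes "psd A"
  obtains U and d :: "'n \<Rightarrow> real" where "unitary U" "\<And>i. 0 \<le> d i"
    "A = U ** diag (\<lambda>i. of_real (d i)) ** dagger U"
proof -
  obtain U and d :: "'n \<Rightarrow> real" where
    U: "unitary U" and A: "A = U ** diag (\<lambda>i. of_real (d i)) ** dagger U"
    using hermitian_diagonalisation[OF psd_hermitian[OF assms]] by blast
  have "0 \<le> d i" for i
  proof -
    \<comment> \<open>Column \<open>i\<close> of \<open>U\<close> is a unit eigenvector, so the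
      quadratic form takes the value \<open>d i\<close> there.\<close>
    have "dagger U *v (U *v axis i 1) = axis i 1"
      by (simp add: matrix_vector_mul_assoc unitary_dagger_mult[OF U])
    then have "cip (U *v axis i 1) (A *v (U *v axis i 1)) = of_real (d i)"
      unfolding A cip_diagonalised
      by (simp add: axis_def if_distrib[of cmod] if_distrib[of "\<lambda>x. x ^ 2"] if_distrib[of "\<lambda>x. _ * x"] cong: if_cong)
    then show ?thesis
      using assms by (metis nonneg_Reals_of_real_iff psd_cip)
  qed
  with U A that show thesis by blast
qed

lemma psd_trace_nonneg: "psd A \<Longrightarrow> trace A \<in> \<real>\<^sub>\<ge>\<^sub>0"
  by (erule psd_diagonalisation) (auto simp: trace_diagonalised sum_nonneg complex_nonneg_Reals_iff)

text \<open>Nonnegative eigenvalues with sum zero all vanish. This disposes of measurement outcomes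
  of probability zero.\<close>

lemma psd_trace_0:
  assumes "psd A" "trace A = 0"
  shows "A = 0"
proof -
  obtain U and d :: "'a \<Rightarrow> real" where U: "unitary U" "\<And>i. 0 \<le> d i"
    and A: "A = U ** diag (\<lambda>i. of_real (d i)) ** dagger U"
    using psd_diagonalisation[OF assms(1)] by blast
  have "complex_of_real (\<Sum>i\<in>UNIV. d i) = 0"
    using assms(2) by (simp add: A trace_diagonalised[OF U(1)])
  then have "(\<Sum>i\<in>UNIV. d i) = 0" by (simp only: of_real_eq_0_iff)
  then have "d i = 0" for i
    using U(2) by (simp add: sum_nonneg_eq_0_iff)
  then show ?thesis by (simp add: A vec_eq_iff matrix_matrix_mult_def)
qed

lemma trace_scaleR: "trace (t *\<^sub>R A) = t *\<^sub>R trace A" for A :: "complex^'n^'n"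
  by (simp add: trace_def scaleR_sum_right)

lemma psd_scaleR: "0 \<le> t \<Longrightarrow> psd A \<Longrightarrow> psd (t *\<^sub>R A)"
proof -
  assume "0 \<le> t" "psd A"
  moreover have "(t *\<^sub>R A) *v v = t *\<^sub>R (A *v v)" for v
    by (simp add: vec_eq_iff matrix_vector_mult_def scaleR_sum_right)
  ultimately show ?thesis
    by (auto simp: psd_cip cip_scaleR_right scaleR_conv_of_real[where 'a = complex] intro!: nonneg_Reals_mult_I)
qed

lemma psd_sum:
  assumes "\<And>k. k \<in> K \<Longrightarrow> psd (A k)"
  shows "psd (\<Sum>k\<in>K. A k)"
  using assms
proof (induction K rule: infinite_finite_induct)
  case (insert k K)
  then show ?case
    by (simp add: psd_cip matrix_vector_mult_add_rdistrib cip_add_right)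
qed (simp_all add: psd_cip cip_def)

lemma psd_mat_1: "psd (mat 1)"
  by (simp add: psd_cip cip_self complex_nonneg_Reals_iff)

text \<open>The quadratic form at \<open>v\<close> is the squared modulus of the overlap of
  \<open>f\<close> with \<open>v\<close>.\<close>

lemma psd_rank_one:
  fixes f :: "'n::finite \<Rightarrow> complex"
  shows "psd (\<chi> k l. f k * cnj (f l))"
proof -
  have "cip v ((\<chi> k l. f k * cnj (f l)) *v v) = of_real ((cmod (cip (vec_lambda f) v))\<^sup>2)" for v
    unfolding complex_norm_square
    by (simp add: cip_def matrix_vector_mult_def sum_distrib_left sum_distrib_right mult_ac)
      (rule sum.swap)
  then show ?thesis
    by (simp add: psd_cip complex_nonneg_Reals_iff)
qed

lemma diagonalised_nth:
  "(U ** diag d ** dagger U) $ i $ j = (\<Sum>m\<in>UNIV. d m * (U $ i $ m * cnj (U $ j $ m)))"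
  by (simp add: matrix_matrix_mult_def[of _ "dagger U"] mult_ac)

subsection \<open>Strict concavity\<close>

text \<open>The tangent of a strictly concave function lies above its graph and touches it only at
  the base point. The base point must be positive for the slope to make sense, whereas
  \<open>x\<close> may be zero.\<close>

lemma powr_tangent:
  fixes x l \<alpha> :: real
  assumes "0 < \<alpha>" "\<alpha> < 1" "0 < l" "0 \<le> x"
  shows "x powr \<alpha> \<le> l powr \<alpha> + \<alpha> * l powr (\<alpha> - 1) * (x - l)"
    and "x powr \<alpha> = l powr \<alpha> + \<alpha> * l powr (\<alpha> - 1) * (x - l) \<Longrightarrow> x = l"
proof -
  have key: "x powr \<alpha> < l powr \<alpha> + \<alpha> * l powr (\<alpha> - 1) * (x - l)" if "x \<noteq> l"
  proof (cases "x = 0")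
    case True
    \<comment> \<open>At \<open>x = 0\<close> the tangent takes the positive value
      \<open>(1 - \<alpha>) * l powr \<alpha>\<close>.\<close>
    have "l powr \<alpha> = l * l powr (\<alpha> - 1)"
      using assms by (simp add: powr_diff)
    then show ?thesis using True assms by (simp add: algebra_simps)
  next
    case False
    then have x: "x > 0" using assms by simp
    txt \<open>With \<open>x = l exp s\<close>, the claim is the weighted sum of the strict bounds \<open>exp y > 1 + y\<close> at
      \<open>y = - \<alpha> s\<close> and \<open>y = (1 - \<alpha>) s\<close>.\<close>
    define s where "s = ln (x / l)"
    have "s \<noteq> 0" using x assms that by (simp add: s_def)
    have ex: "exp y > 1 + y" if "y \<noteq> 0" for y :: real
      using that exp_ge_add_one_self[of y] ln_eq_minus_one[OF exp_gt_zero, of y]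
      by (metis add_diff_cancel_left' exp_eq_one_iff less_le ln_exp)
    have 1: "x = l * exp s" using x assms by (simp add: s_def)
    have 2: "x powr \<alpha> = l powr \<alpha> * exp (\<alpha> * s)"
      using x assms by (simp add: 1 powr_mult exp_powr_real mult.commute)
    have "(1 - \<alpha>) * (1 + - \<alpha> * s) + \<alpha> * (1 + (1 - \<alpha>) * s) < (1 - \<alpha>) * exp (- \<alpha> * s) + \<alpha> * exp ((1 - \<alpha>) * s)"
      using assms \<open>s \<noteq> 0\<close> by (intro add_strict_mono mult_strict_left_mono ex) auto
    then have "1 < (1 - \<alpha>) * exp (- \<alpha> * s) + \<alpha> * exp ((1 - \<alpha>) * s)"
      by (simp add: algebra_simps)
    then have "exp (\<alpha> * s) * 1 < exp (\<alpha> * s) * ((1 - \<alpha>) * exp (- \<alpha> * s) + \<alpha> * exp ((1 - \<alpha>) * s))"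
      by (intro mult_strict_left_mono) auto
    also have "\<dots> = (1 - \<alpha>) + \<alpha> * exp s"
      by (simp add: distrib_left mult.left_commute exp_add[symmetric] algebra_simps)
    finally have "l powr \<alpha> * exp (\<alpha> * s) < l powr \<alpha> * ((1 - \<alpha>) + \<alpha> * exp s)"
      using assms by simp
    also have "\<dots> = l powr \<alpha> + \<alpha> * l powr (\<alpha> - 1) * (x - l)"
      using assms by (simp add: 1 powr_diff field_simps)
    finally show ?thesis unfolding 2 .
  qed
  then show "x powr \<alpha> \<le> l powr \<alpha> + \<alpha> * l powr (\<alpha> - 1) * (x - l)"
    by (cases "x = l") auto
  show "x powr \<alpha> = l powr \<alpha> + \<alpha> * l powr (\<alpha> - 1) * (x - l) \<Longrightarrow> x = l"
    using key by fastforce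
qed

text \<open>The weighted gaps \<open>g j\<close> between the tangent at the mean and the function
  are nonnegative, and the linear terms cancel in their sum. Equality therefore makes every weighted
  gap vanish.\<close>

lemma powr_jensen:
  fixes q x :: "'j \<Rightarrow> real"
  assumes "0 < \<alpha>" "\<alpha> < 1" and J: "finite J" "\<And>j. j \<in> J \<Longrightarrow> 0 \<le> q j" "(\<Sum>j\<in>J. q j) = 1"
    and x: "\<And>j. j \<in> J \<Longrightarrow> 0 \<le> x j"
  defines "l \<equiv> \<Sum>j\<in>J. q j * x j"
  shows "(\<Sum>j\<in>J. q j * x j powr \<alpha>) \<le> l powr \<alpha>"
    and "(\<Sum>j\<in>J. q j * x j powr \<alpha>) = l powr \<alpha> \<Longrightarrow> \<forall>j\<in>J. q j \<noteq> 0 \<longrightarrow> x j = l"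
proof -
  have "l \<ge> 0" unfolding l_def using J x by (intro sum_nonneg) auto
  txt \<open>For \<open>l = 0\<close> the tangent is junk (\<open>0 powr (\<alpha> - 1) = 0\<close>), but then all terms vanish.\<close>
  define g where "g j = q j * (l powr \<alpha> + \<alpha> * l powr (\<alpha> - 1) * (x j - l) - x j powr \<alpha>)" for j
  have g: "g j \<ge> 0 \<and> (g j = 0 \<longrightarrow> q j \<noteq> 0 \<longrightarrow> x j = l)" if "j \<in> J" for j
  proof (cases "l = 0")
    case True
    then have "q j * x j = 0"
      using that J x by (simp add: l_def sum_nonneg_eq_0_iff)
    then show ?thesis using True by (auto simp: g_def)
  next
    case False
    then have "l > 0" using \<open>l \<ge> 0\<close> by simp
    from powr_tangent[OF assms(1,2) this x[OF that]] show ?thesis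
      using J(2)[OF that] by (auto simp: g_def)
  qed
  have "(\<Sum>j\<in>J. g j) = (\<Sum>j\<in>J. q j) * (l powr \<alpha> - \<alpha> * l powr (\<alpha> - 1) * l)
      + \<alpha> * l powr (\<alpha> - 1) * (\<Sum>j\<in>J. q j * x j) - (\<Sum>j\<in>J. q j * x j powr \<alpha>)"
    by (simp add: g_def sum_distrib_left sum_distrib_right sum.distrib[symmetric] sum_subtractf[symmetric]
        algebra_simps)
  then have sum_g: "(\<Sum>j\<in>J. g j) = l powr \<alpha> - (\<Sum>j\<in>J. q j * x j powr \<alpha>)"
    by (simp add: J(3) flip: l_def)
  show "(\<Sum>j\<in>J. q j * x j powr \<alpha>) \<le> l powr \<alpha>"
    using sum_nonneg[of J g] g sum_g by simp
  assume "(\<Sum>j\<in>J. q j * x j powr \<alpha>) = l powr \<alpha>"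
  then have "\<forall>j\<in>J. g j = 0"
    using sum_g g J(1) by (simp add: sum_nonneg_eq_0_iff)
  then show "\<forall>j\<in>J. q j \<noteq> 0 \<longrightarrow> x j = l"
    using g by blast
qed

lemma unitary_sum_cmod_square:
  assumes "unitary U"
  shows "(\<Sum>j\<in>UNIV. (cmod (U $ i $ j))\<^sup>2) = 1"
    and "(\<Sum>i\<in>UNIV. (cmod (U $ i $ j))\<^sup>2) = 1"
proof -
  have "(\<Sum>j\<in>UNIV. complex_of_real ((cmod (U $ i $ j))\<^sup>2)) = (U ** dagger U) $ i $ i"
    unfolding complex_norm_square by (simp add: matrix_matrix_mult_def)
  also have "\<dots> = of_real 1"
    using assms by (simp add: unitary_def mat_def)
  finally show "(\<Sum>j\<in>UNIV. (cmod (U $ i $ j))\<^sup>2) = 1"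
    unfolding of_real_sum[symmetric] of_real_eq_iff .
  have "(\<Sum>i\<in>UNIV. complex_of_real ((cmod (U $ i $ j))\<^sup>2)) = (dagger U ** U) $ j $ j"
    unfolding complex_norm_square by (simp add: matrix_matrix_mult_def mult.commute)
  also have "\<dots> = of_real 1"
    using assms by (simp add: unitary_def mat_def)
  finally show "(\<Sum>i\<in>UNIV. (cmod (U $ i $ j))\<^sup>2) = 1"
    unfolding of_real_sum[symmetric] of_real_eq_iff .
qed

lemma unitary_dagger_times:
  assumes "unitary U" "unitary V"
  shows "unitary (dagger V ** U)"
  unfolding unitary_def dagger_mult dagger_dagger
  by (simp add: matrix_mul_assoc[symmetric] unitary_dagger_mult[OF assms(1)] unitary_dagger_mult[OF assms(2)])

lemma matrix_mult_scaleR_sum: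
  fixes A :: "'k \<Rightarrow> complex^'n^'n"
  shows "B ** (\<Sum>k\<in>K. p k *\<^sub>R A k) ** C = (\<Sum>k\<in>K. p k *\<^sub>R (B ** A k ** C))"
proof (induction K rule: infinite_finite_induct)
  case (insert k K)
  have "B ** (p k *\<^sub>R A k + X) ** C = p k *\<^sub>R (B ** A k ** C) + B ** X ** C" for X
    by (simp add: vec_eq_iff matrix_matrix_mult_def scaleR_sum_right sum_distrib_left
        sum_distrib_right sum.distrib distrib_left distrib_right)
  then show ?case using insert by simp
qed (simp_all add: vec_eq_iff matrix_matrix_mult_def)

lemma trace_powr_strictly_concave:
  fixes \<sigma> :: "'k \<Rightarrow> complex^'n^'n"
  assumes "0 < \<alpha>" "\<alpha> < 1" and K: "finite K" "\<And>k. k \<in> K \<Longrightarrow> 0 < p k" "(\<Sum>k\<in>K. p k) = 1"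
    and psd: "\<And>k. k \<in> K \<Longrightarrow> psd (\<sigma> k)" "psd (\<Sum>k\<in>K. p k *\<^sub>R \<sigma> k)"
    and le: "Re (trace (op_powr (\<Sum>k\<in>K. p k *\<^sub>R \<sigma> k) \<alpha>)) \<le> (\<Sum>k\<in>K. p k * Re (trace (op_powr (\<sigma> k) \<alpha>)))"
    and "k \<in> K"
  shows "\<sigma> k = (\<Sum>k\<in>K. p k *\<^sub>R \<sigma> k)"
proof -
  define \<tau> where "\<tau> = (\<Sum>k\<in>K. p k *\<^sub>R \<sigma> k)"
  obtain U and l :: "'n \<Rightarrow> real" where U: "unitary U" and l: "\<And>i. 0 \<le> l i"
    and \<tau>: "\<tau> = U ** diag (\<lambda>i. of_real (l i)) ** dagger U"
    using psd_diagonalisation[OF psd(2)] unfolding \<tau>_def by blast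
  have "\<forall>k\<in>K. \<exists>V (m :: 'n \<Rightarrow> real). unitary V \<and> (\<forall>j. 0 \<le> m j) \<and>
      \<sigma> k = V ** diag (\<lambda>i. of_real (m i)) ** dagger V"
    using psd_diagonalisation[OF psd(1)] by metis
  then obtain V and m :: "'k \<Rightarrow> 'n \<Rightarrow> real" where V: "\<And>k. k \<in> K \<Longrightarrow> unitary (V k)"
    and m: "\<And>k j. k \<in> K \<Longrightarrow> 0 \<le> m k j"
    and \<sigma>: "\<And>k. k \<in> K \<Longrightarrow> \<sigma> k = V k ** diag (\<lambda>i. of_real (m k i)) ** dagger (V k)"
    by metis
  \<comment> \<open>Squared overlap of eigenvector \<open>j\<close> of \<open>\<sigma> k\<close>
    with eigenvector \<open>i\<close> of \<open>\<tau>\<close>; for each \<open>k\<close> in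
    \<open>K\<close> these numbers form a doubly stochastic matrix.\<close>
  define w where "w k j i = (cmod ((dagger (V k) ** U) $ j $ i))\<^sup>2" for k j i
  have w_sum: "(\<Sum>j\<in>UNIV. w k j i) = 1" "(\<Sum>i\<in>UNIV. w k j i) = 1" if "k \<in> K" for k i j
    unfolding w_def by (intro unitary_sum_cmod_square unitary_dagger_times U V that)+
  have w_nonneg: "0 \<le> w k j i" for k j i by (simp add: w_def)
  \<comment> \<open>The eigenvalue \<open>l i\<close> is the diagonal entry of \<open>\<tau>\<close>
    in its own eigenbasis. Expanding each \<open>\<sigma> k\<close> in its eigenbasis exhibits it as
    a mean of all the \<open>m k j\<close>.\<close>
  have mean: "l i = (\<Sum>k\<in>K. p k * (\<Sum>j\<in>UNIV. w k j i * m k j))" for i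
  proof -
    have "complex_of_real (l i) = (dagger U ** \<tau> ** U) $ i $ i"
      by (simp add: \<tau> unitary_cancel_right[OF U] matrix_mul_assoc[symmetric] unitary_dagger_mult[OF U])
    also have "\<dots> = (\<Sum>k\<in>K. p k *\<^sub>R (dagger U ** \<sigma> k ** U) $ i $ i)"
      by (simp add: \<tau>_def matrix_mult_scaleR_sum)
    also have "\<dots> = (\<Sum>k\<in>K. of_real (p k * (\<Sum>j\<in>UNIV. w k j i * m k j)))"
    proof (intro sum.cong refl)
      fix k assume "k \<in> K"
      define W where "W = dagger (V k) ** U"
      have "dagger U ** \<sigma> k ** U = dagger W ** (diag (\<lambda>i. of_real (m k i)) ** W)"
        by (simp add: \<sigma>[OF \<open>k \<in> K\<close>] W_def dagger_mult matrix_mul_assoc)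
      then have "(dagger U ** \<sigma> k ** U) $ i $ i =
          (\<Sum>j\<in>UNIV. cnj (W $ j $ i) * (of_real (m k j) * W $ j $ i))"
        by (simp add: matrix_matrix_mult_def[of "dagger W"])
      also have "\<dots> = (\<Sum>j\<in>UNIV. of_real (w k j i) * of_real (m k j))"
        unfolding w_def W_def[symmetric] complex_norm_square by (simp add: mult_ac)
      finally show "p k *\<^sub>R (dagger U ** \<sigma> k ** U) $ i $ i = of_real (p k * (\<Sum>j\<in>UNIV. w k j i * m k j))"
        by (simp add: scaleR_conv_of_real)
    qed
    also have "\<dots> = of_real (\<Sum>k\<in>K. p k * (\<Sum>j\<in>UNIV. w k j i * m k j))" by simp
    finally show ?thesis unfolding of_real_eq_iff .
  qed
  \<comment> \<open>Jensen's inequality is applied once for each \<open>i\<close>, over pairs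
    \<open>(k, j)\<close> with weights \<open>p k * w k j i\<close>.\<close>
  define J where "J = K \<times> (UNIV :: 'n set)"
  have sumJ: "(\<Sum>j\<in>J. p (fst j) * w (fst j) (snd j) i * f (fst j) (snd j)) =
      (\<Sum>k\<in>K. p k * (\<Sum>j\<in>UNIV. w k j i * f k j))" for f i
    by (simp add: J_def sum_distrib_left mult.assoc sum.cartesian_product case_prod_beta)
  have J: "finite J" "\<And>j. j \<in> J \<Longrightarrow> 0 \<le> p (fst j) * w (fst j) (snd j) i"
    "(\<Sum>j\<in>J. p (fst j) * w (fst j) (snd j) i) = 1"
    "\<And>j. j \<in> J \<Longrightarrow> 0 \<le> m (fst j) (snd j)" for i
    using K sumJ[of i "\<lambda>_ _. 1"] m w_nonneg
    by (auto simp: J_def w_sum less_imp_le intro!: mult_nonneg_nonneg)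
  note jensen = powr_jensen[OF assms(1,2) J(1,2,3), of "\<lambda>j. m (fst j) (snd j)", OF _ J(4),
      unfolded sumJ sumJ[where f = "\<lambda>k j. m k j powr \<alpha>"], folded mean]
  define h where "h i = (\<Sum>k\<in>K. p k * (\<Sum>j\<in>UNIV. w k j i * m k j powr \<alpha>))" for i
  have h_le: "h i \<le> l i powr \<alpha>" for i
    using jensen(1) unfolding h_def .
  \<comment> \<open>Summing the weights over \<open>i\<close> gives one, so the \<open>h i\<close>
    add up to the averaged trace of powers. The assumed inequality runs against \<open>h_le\<close>,
    which forces equality for every \<open>i\<close>.\<close>
  have "(\<Sum>i\<in>UNIV. l i powr \<alpha>) \<le> (\<Sum>k\<in>K. p k * (\<Sum>j\<in>UNIV. m k j powr \<alpha>))"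
    using le trace_op_powr[OF U \<tau>] trace_op_powr[OF V \<sigma>] by (simp flip: \<tau>_def)
  also have "\<dots> = (\<Sum>k\<in>K. p k * (\<Sum>j\<in>UNIV. (\<Sum>i\<in>UNIV. w k j i) * m k j powr \<alpha>))"
    by (simp add: w_sum)
  also have "\<dots> = (\<Sum>k\<in>K. p k * (\<Sum>i\<in>UNIV. \<Sum>j\<in>UNIV. w k j i * m k j powr \<alpha>))"
    unfolding sum_distrib_right by (subst sum.swap) (rule refl)
  also have "\<dots> = (\<Sum>i\<in>UNIV. h i)"
    unfolding h_def sum_distrib_left[of "p _"] by (subst sum.swap) (rule refl)
  finally have "(\<Sum>i\<in>UNIV. l i powr \<alpha> - h i) = 0"
    using sum_mono[of UNIV h "\<lambda>i. l i powr \<alpha>"] h_le by (simp add: sum_subtractf)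
  then have "h i = l i powr \<alpha>" for i
    using h_le by (simp add: sum_nonneg_eq_0_iff)
  then have eq: "w k j i \<noteq> 0 \<Longrightarrow> m k j = l i" for i j
    using jensen(2)[of i] K(2)[OF \<open>k \<in> K\<close>] \<open>k \<in> K\<close> unfolding h_def
    by (auto simp: J_def)
  have "\<tau> = \<sigma> k"
    unfolding \<tau> \<sigma>[OF \<open>k \<in> K\<close>] diagonalisation_eq_iff[OF U V[OF \<open>k \<in> K\<close>]]
    using eq by (simp add: w_def)
  then show ?thesis by (simp add: \<tau>_def)
qed

section \<open>From traces of powers to the entropy divergence\<close>

lemma trace_op_powr_pos:
  assumes "state A"
  shows "0 < Re (trace (op_powr A \<alpha>))"
proof -
  obtain U and d :: "'a \<Rightarrow> real" where U: "unitary U" "\<And>i. 0 \<le> d i"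
    and A: "A = U ** diag (\<lambda>i. of_real (d i)) ** dagger U"
    using psd_diagonalisation assms unfolding state_def by metis
  have "complex_of_real (\<Sum>i\<in>UNIV. d i) = of_real 1"
    using assms by (simp add: A trace_diagonalised[OF U(1)] state_def)
  then have "(\<Sum>i\<in>UNIV. d i) = 1" by (simp only: of_real_eq_iff)
  \<comment> \<open>One nonzero eigenvalue suffices for a positive trace of the power, so that the
    entropy takes the logarithm of a positive number.\<close>
  then obtain i where "d i \<noteq> 0"
    by (metis sum.neutral zero_neq_one)
  then have "0 < (\<Sum>i\<in>UNIV. d i powr \<alpha>)"
    by (intro sum_pos2[of _ i]) auto
  then show ?thesis by (simp add: trace_op_powr[OF U(1) A])
qed

text \<open>As \<open>1 / (1 - \<alpha>)\<close> is positive, the hypothesis bounds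
  \<open>ln c\<close> by the mean of the \<open>ln (y k)\<close>. Bounding each of these by the
  tangent of \<open>ln\<close> at \<open>c\<close> and averaging gives
  \<open>c \<le> (\<Sum>k\<in>K. p k * y k)\<close>, the inequality that only a constant ensemble
  satisfies.\<close>

lemma qjsd_le_0_imp_constant:
  fixes \<sigma> :: "'k \<Rightarrow> complex^'n^'n"
  assumes \<alpha>: "0 < \<alpha>" "\<alpha> < 1" and K: "finite K" "\<And>k. k \<in> K \<Longrightarrow> 0 < p k" "(\<Sum>k\<in>K. p k) = 1"
    and states: "\<And>k. k \<in> K \<Longrightarrow> state (\<sigma> k)" "state (\<Sum>k\<in>K. p k *\<^sub>R \<sigma> k)"
    and le: "qjsd \<alpha> K p \<sigma> \<le> 0" and "k \<in> K"
  shows "\<sigma> k = (\<Sum>k\<in>K. p k *\<^sub>R \<sigma> k)"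
proof (rule trace_powr_strictly_concave[OF \<alpha> K])
  define c where "c = Re (trace (op_powr (\<Sum>k\<in>K. p k *\<^sub>R \<sigma> k) \<alpha>))"
  define y where "y k = Re (trace (op_powr (\<sigma> k) \<alpha>))" for k
  have c: "c > 0" and y: "\<And>k. k \<in> K \<Longrightarrow> y k > 0"
    unfolding c_def y_def using states trace_op_powr_pos by blast+
  have "qjsd \<alpha> K p \<sigma> = 1 / (1 - \<alpha>) * (ln c - (\<Sum>k\<in>K. p k * ln (y k)))"
    by (simp add: qjsd_def renyi_entropy_def c_def y_def sum_divide_distrib diff_divide_distrib)
  then have "ln c \<le> (\<Sum>k\<in>K. p k * ln (y k))"
    using le \<alpha> by (simp add: divide_le_0_iff)
  also have "\<dots> \<le> (\<Sum>k\<in>K. p k * (ln c + (y k / c - 1)))"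
  proof (intro sum_mono mult_left_mono)
    fix k assume "k \<in> K"
    then have "0 < y k" by (rule y)
    then show "ln (y k) \<le> ln c + (y k / c - 1)"
      using ln_le_minus_one[of "y k / c"] c by (simp add: ln_div)
  qed (use K in \<open>simp add: less_imp_le\<close>)
  also have "\<dots> = (\<Sum>k\<in>K. p k) * (ln c - 1) + (\<Sum>k\<in>K. p k * y k) / c"
    by (simp add: sum_distrib_left sum_divide_distrib sum.distrib sum_subtractf algebra_simps)
  finally have "c \<le> (\<Sum>k\<in>K. p k * y k)"
    using c K(3) by (simp add: pos_le_divide_eq)
  then show "Re (trace (op_powr (\<Sum>k\<in>K. p k *\<^sub>R \<sigma> k) \<alpha>)) \<le> (\<Sum>k\<in>K. p k * Re (trace (op_powr (\<sigma> k) \<alpha>)))"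
    by (simp add: c_def y_def)
qed (use assms in \<open>auto simp: state_def\<close>)

subsection \<open>Local measurements\<close>

lemma sum_UNIV_prod: "(\<Sum>x\<in>UNIV. f x) = (\<Sum>i\<in>UNIV. \<Sum>k\<in>UNIV. f (i, k))"
  by (simp add: sum.cartesian_product case_prod_beta flip: UNIV_Times_UNIV)

lemma sum_rotate:
  "(\<Sum>l\<in>L. \<Sum>j\<in>J. \<Sum>k\<in>K. g l j k) = (\<Sum>j\<in>J. \<Sum>k\<in>K. \<Sum>l\<in>L. g l j k)"
  by (subst sum.swap) (rule sum.cong[OF refl sum.swap])

text \<open>The identity on \<open>A\<close> fixes the row index \<open>i\<close>. On
  \<open>B\<close> the indices \<open>k\<close> and \<open>l\<close> occur in opposite order in
  \<open>E\<close> and \<open>\<rho>\<close>, as in the trace of a product.\<close>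

lemma unnormalised_post_nth:
  fixes \<rho> :: "complex^('a::finite \<times> 'b::finite)^('a \<times> 'b)"
  shows "unnormalised_post \<rho> E $ i $ j = (\<Sum>k\<in>UNIV. \<Sum>l\<in>UNIV. E $ k $ l * \<rho> $ (i, l) $ (j, k))"
proof -
  have "(\<Sum>l\<in>UNIV. tensor (mat 1) E $ (i, k) $ (a, l) * \<rho> $ (a, l) $ (j, k)) =
      (if a = i then \<Sum>l\<in>UNIV. E $ k $ l * \<rho> $ (i, l) $ (j, k) else 0)" for a k
    by (auto simp: tensor_def mat_def)
  then show ?thesis
    by (simp add: unnormalised_post_def ptrace_B_def matrix_matrix_mult_def sum_UNIV_prod)
qed

text \<open>This is the trace of \<open>E ** ptrace_A \<rho>\<close> written out: outcome
  probabilities depend only on the reduced state on \<open>B\<close>.\<close>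

lemma trace_unnormalised_post:
  fixes \<rho> :: "complex^('a::finite \<times> 'b::finite)^('a \<times> 'b)"
  shows "trace (unnormalised_post \<rho> E) = (\<Sum>k\<in>UNIV. \<Sum>l\<in>UNIV. E $ k $ l * ptrace_A \<rho> $ l $ k)"
  unfolding trace_def unnormalised_post_nth
  by (subst sum_rotate) (simp add: ptrace_A_def sum_distrib_left)

lemma unnormalised_post_sum:
  "unnormalised_post \<rho> (\<Sum>x\<in>X. M x) = (\<Sum>x\<in>X. unnormalised_post \<rho> (M x))"
proof -
  have "(\<Sum>k\<in>UNIV. \<Sum>l\<in>UNIV. \<Sum>x\<in>X. M x $ k $ l * \<rho> $ (i, l) $ (j, k)) =
      (\<Sum>x\<in>X. \<Sum>k\<in>UNIV. \<Sum>l\<in>UNIV. M x $ k $ l * \<rho> $ (i, l) $ (j, k))" for i j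
    by (rule sum_rotate[symmetric])
  then show ?thesis
    by (simp add: vec_eq_iff unnormalised_post_nth sum_distrib_right)
qed

lemma unnormalised_post_scaleR:
  "unnormalised_post \<rho> (t *\<^sub>R E) = t *\<^sub>R unnormalised_post \<rho> E"
  by (simp add: vec_eq_iff unnormalised_post_nth scaleR_sum_right)

lemma unnormalised_post_mat_1: "unnormalised_post \<rho> (mat 1) = ptrace_B \<rho>"
  by (simp add: vec_eq_iff unnormalised_post_nth ptrace_B_def mat_def if_distrib[of "\<lambda>x. x * _"] cong: if_cong)

lemma trace_ptrace_B: "trace (ptrace_B \<rho>) = trace \<rho>"
  for \<rho> :: "complex^('a::finite \<times> 'b::finite)^('a \<times> 'b)"
  by (simp add: trace_def ptrace_B_def sum_UNIV_prod)

text \<open>The vector \<open>w f v\<close> is the product vector of \<open>v\<close> and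
  \<open>f\<close>. Positivity of \<open>\<rho>\<close> on product vectors thus yields positivity on
  \<open>A\<close> after a rank-one effect.\<close>

lemma cip_unnormalised_post_rank_one:
  fixes \<rho> :: "complex^('a::finite \<times> 'b::finite)^('a \<times> 'b)"
  defines "w f v \<equiv> \<chi> x. v $ fst x * f (snd x)"
  shows "cip v (unnormalised_post \<rho> (\<chi> k l. f k * cnj (f l)) *v v) = cip (w f v) (\<rho> *v w f v)"
proof -
  have "cip (w f v) (\<rho> *v w f v) = (\<Sum>i\<in>UNIV. \<Sum>l\<in>UNIV. \<Sum>j\<in>UNIV. \<Sum>k\<in>UNIV.
      cnj (v $ i) * cnj (f l) * (\<rho> $ (i, l) $ (j, k) * (v $ j * f k)))"
    by (simp add: cip_def matrix_vector_mult_def w_def sum_UNIV_prod sum_distrib_left)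
  also have "\<dots> = (\<Sum>i\<in>UNIV. \<Sum>j\<in>UNIV. \<Sum>k\<in>UNIV. \<Sum>l\<in>UNIV.
      cnj (v $ i) * cnj (f l) * (\<rho> $ (i, l) $ (j, k) * (v $ j * f k)))"
    by (intro sum.cong refl sum_rotate)
  finally show ?thesis
    by (simp add: cip_def matrix_vector_mult_def unnormalised_post_nth sum_distrib_left
        sum_distrib_right mult_ac)
qed

text \<open>The spectral decomposition writes \<open>E\<close> as a nonnegative combination of
  rank-one effects, and \<open>unnormalised_post\<close> is linear in the effect.\<close>

lemma psd_unnormalised_post:
  fixes \<rho> :: "complex^('a::finite \<times> 'b::finite)^('a \<times> 'b)"
  assumes "psd \<rho>" "psd E"
  shows "psd (unnormalised_post \<rho> E)"
proof -
  obtain U and d :: "'b \<Rightarrow> real" where d: "\<And>i. 0 \<le> d i"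
    and E: "E = U ** diag (\<lambda>i. of_real (d i)) ** dagger U"
    using psd_diagonalisation[OF assms(2)] by metis
  have "E = (\<Sum>m\<in>UNIV. d m *\<^sub>R (\<chi> k l. U $ k $ m * cnj (U $ l $ m)))"
    by (simp add: vec_eq_iff E diagonalised_nth scaleR_conv_of_real[where 'a = complex])
  then show ?thesis
    using assms(1) d
    by (auto simp: unnormalised_post_sum unnormalised_post_scaleR psd_cip[of "unnormalised_post _ _"]
        cip_unnormalised_post_rank_one psd_cip[of \<rho>] intro!: psd_sum psd_scaleR)
qed

lemma povm_sum_unnormalised_post:
  assumes "povm n M"
  shows "(\<Sum>x<n. unnormalised_post \<rho> (M x)) = ptrace_B \<rho>"
  using assms by (simp add: povm_def unnormalised_post_mat_1 flip: unnormalised_post_sum)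

lemma outcome_prob:
  assumes "psd \<rho>" "psd E"
  shows "trace (unnormalised_post \<rho> E) = of_real (outcome_prob \<rho> E)" "0 \<le> outcome_prob \<rho> E"
  using psd_trace_nonneg[OF psd_unnormalised_post[OF assms]]
  by (auto simp: outcome_prob_def complex_nonneg_Reals_iff complex_eq_iff)

text \<open>At probability zero the division in \<open>post_state\<close> returns a default value,
  but the positive operator on the left has trace zero and so vanishes too.\<close>

lemma unnormalised_post_eq:
  assumes "psd \<rho>" "psd E"
  shows "unnormalised_post \<rho> E = outcome_prob \<rho> E *\<^sub>R post_state \<rho> E"
proof (cases "outcome_prob \<rho> E = 0")
  case True
  then have "unnormalised_post \<rho> E = 0"
    using psd_trace_0[OF psd_unnormalised_post[OF assms]] outcome_prob(1)[OF assms] by simp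
  then show ?thesis using True by simp
qed (simp add: post_state_def)

lemma state_post_state:
  assumes "psd \<rho>" "psd E" "outcome_prob \<rho> E \<noteq> 0"
  shows "state (post_state \<rho> E)"
  using assms outcome_prob[OF assms(1,2)] psd_unnormalised_post[OF assms(1,2)]
  by (simp add: state_def post_state_def trace_scaleR psd_scaleR scaleR_conv_of_real[where 'a = complex])

text \<open>The effects sum to the identity, so every measurement on \<open>B\<close> leaves the
  average state on \<open>A\<close> unchanged; dropped outcomes carry weight zero.\<close>

lemma measured_ensemble:
  fixes \<rho> :: "complex^('a::finite \<times> 'b::finite)^('a \<times> 'b)"
  assumes "state \<rho>" "povm n M"
  defines "K \<equiv> {x. x < n \<and> outcome_prob \<rho> (M x) \<noteq> 0}"
  shows "(\<Sum>x\<in>K. outcome_prob \<rho> (M x)) = 1"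
    and "(\<Sum>x\<in>K. outcome_prob \<rho> (M x) *\<^sub>R post_state \<rho> (M x)) = ptrace_B \<rho>"
proof -
  have psd: "psd \<rho>" "\<And>x. x < n \<Longrightarrow> psd (M x)"
    using assms by (auto simp: state_def povm_def)
  have K: "K \<subseteq> {..<n}" "finite {..<n}" by (auto simp: K_def)
  have "(\<Sum>x\<in>K. outcome_prob \<rho> (M x) *\<^sub>R post_state \<rho> (M x)) =
      (\<Sum>x<n. outcome_prob \<rho> (M x) *\<^sub>R post_state \<rho> (M x))"
    using K by (intro sum.mono_neutral_left) (auto simp: K_def)
  also have "\<dots> = (\<Sum>x<n. unnormalised_post \<rho> (M x))"
    using psd by (intro sum.cong) (auto simp: unnormalised_post_eq)
  also have "\<dots> = ptrace_B \<rho>"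
    by (rule povm_sum_unnormalised_post[OF assms(2)])
  finally show *: "(\<Sum>x\<in>K. outcome_prob \<rho> (M x) *\<^sub>R post_state \<rho> (M x)) = ptrace_B \<rho>" .
  have "(\<Sum>x\<in>K. outcome_prob \<rho> (M x)) = (\<Sum>x<n. outcome_prob \<rho> (M x))"
    using K by (intro sum.mono_neutral_left) (auto simp: K_def)
  also have "\<dots> = Re (trace (\<Sum>x<n. unnormalised_post \<rho> (M x)))"
    by (simp add: outcome_prob_def trace_def) (rule sum.swap)
  also have "\<dots> = 1"
    using assms by (simp add: povm_sum_unnormalised_post trace_ptrace_B state_def)
  finally show "(\<Sum>x\<in>K. outcome_prob \<rho> (M x)) = 1" .
qed

lemma psd_ptrace_B:
  fixes \<rho> :: "complex^('a::finite \<times> 'b::finite)^('a \<times> 'b)"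
  assumes "psd \<rho>"
  shows "psd (ptrace_B \<rho>)"
  using psd_unnormalised_post[OF assms psd_mat_1] by (simp add: unnormalised_post_mat_1)

text \<open>The ensemble is constant and its average is the reduced state. Stating this without
  normalisation also covers outcomes of probability zero.\<close>

lemma measured_qjsd_le_0:
  fixes \<rho> :: "complex^('a::finite \<times> 'b::finite)^('a \<times> 'b)"
  assumes \<alpha>: "0 < \<alpha>" "\<alpha> < 1" and "state \<rho>" "povm n M" "measured_qjsd \<alpha> \<rho> n M \<le> 0" "x < n"
  shows "unnormalised_post \<rho> (M x) = outcome_prob \<rho> (M x) *\<^sub>R ptrace_B \<rho>"
proof -
  have psd: "psd \<rho>" "\<And>x. x < n \<Longrightarrow> psd (M x)"
    using assms by (auto simp: state_def povm_def)
  define K where "K = {x. x < n \<and> outcome_prob \<rho> (M x) \<noteq> 0}"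
  note ens = measured_ensemble[OF assms(3,4), folded K_def]
  have "state (ptrace_B \<rho>)"
    using assms(3) by (simp add: state_def psd_ptrace_B trace_ptrace_B)
  then have "post_state \<rho> (M x) = ptrace_B \<rho>" if "x \<in> K"
    using qjsd_le_0_imp_constant[OF \<alpha>, of K "\<lambda>x. outcome_prob \<rho> (M x)" "\<lambda>x. post_state \<rho> (M x)", unfolded ens]
      that assms(5) psd outcome_prob(2)[OF psd(1)]
    by (auto simp: measured_qjsd_def K_def less_le intro!: state_post_state)
  then show ?thesis
    using unnormalised_post_eq[OF psd(1) psd(2)[OF \<open>x < n\<close>]] \<open>x < n\<close>
    by (cases "x \<in> K") (auto simp: K_def)
qed

section \<open>Vanishing correlation forces a product\<close>

lemma exists_povm:
  fixes E :: "complex^'n^'n"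
  assumes "psd E"
  obtains t M where "0 < t" "povm 2 M" "M 0 = t *\<^sub>R E"
proof -
  obtain U and d :: "'n \<Rightarrow> real" where U: "unitary U" and d: "\<And>i. 0 \<le> d i"
    and E: "E = U ** diag (\<lambda>i. of_real (d i)) ** dagger U"
    using psd_diagonalisation[OF assms] by metis
  \<comment> \<open>The eigenvalue sum bounds each eigenvalue, so \<open>t *\<^sub>R E\<close> is at
    most the identity and its complement can be the second effect. The \<open>1 +\<close> covers
    \<open>E = 0\<close>.\<close>
  define t where "t = 1 / (1 + (\<Sum>i\<in>UNIV. d i))"
  have pos: "0 < 1 + (\<Sum>i\<in>UNIV. d i)"
    using d by (simp add: add_pos_nonneg sum_nonneg)
  then have t: "0 < t" by (simp add: t_def)
  have td: "t * d i \<le> 1" for i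
    using pos d member_le_sum[of i UNIV d] by (simp add: t_def)
  have "mat 1 - t *\<^sub>R E = U ** diag (\<lambda>i. of_real (1 - t * d i)) ** dagger U"
    unfolding unitary_dagger_mult(2)[OF U, symmetric]
    by (simp add: vec_eq_iff E diagonalised_nth matrix_matrix_mult_def[of U "dagger U"] algebra_simps
        sum_subtractf scaleR_conv_of_real[where 'a = complex] sum_distrib_left)
  then have "psd (mat 1 - t *\<^sub>R E)"
    using psd_diagonalised[of "\<lambda>i. 1 - t * d i" U] td by simp
  then have "povm 2 (\<lambda>x. if x = 0 then t *\<^sub>R E else mat 1 - t *\<^sub>R E)"
    using t assms by (auto simp: povm_def psd_scaleR less_imp_le numeral_2_eq_2)
  then show thesis using that t by simp
qed

lemma correlation_0_imp_product:
  fixes \<rho> :: "complex^('a::finite \<times> 'b::finite)^('a \<times> 'b)"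
  assumes \<alpha>: "0 < \<alpha>" "\<alpha> < 1" and "state \<rho>"
    and le: "\<And>n M. povm n M \<Longrightarrow> measured_qjsd \<alpha> \<rho> n M \<le> 0"
  shows "\<rho> = tensor (ptrace_B \<rho>) (ptrace_A \<rho>)"
proof -
  have eff: "unnormalised_post \<rho> E = outcome_prob \<rho> E *\<^sub>R ptrace_B \<rho>" if E: "psd E" for E
  proof -
    obtain t M where t: "0 < t" and M: "povm 2 M" "M 0 = t *\<^sub>R E"
      using exists_povm[OF E] by metis
    have "unnormalised_post \<rho> (t *\<^sub>R E) = outcome_prob \<rho> (t *\<^sub>R E) *\<^sub>R ptrace_B \<rho>"
      using measured_qjsd_le_0[OF \<alpha> assms(3) M(1) le[OF M(1)], of 0] M(2) by simp
    \<comment> \<open>Both sides are linear in the effect, so the positive factor \<open>t\<close>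
      cancels.\<close>
    then show ?thesis
      using t by (simp add: outcome_prob_def unnormalised_post_scaleR trace_scaleR flip: scaleR_scaleR)
  qed
  have "\<rho> $ (i, l) $ (j, k) = ptrace_B \<rho> $ i $ j * ptrace_A \<rho> $ l $ k" for i j k l
  proof -
    define G :: "complex^'b^'b" where
      "G = (\<chi> l k. \<rho> $ (i, l) $ (j, k) - ptrace_B \<rho> $ i $ j * ptrace_A \<rho> $ l $ k)"
    have "cip v (G *v v) = 0" for v
    proof -
      \<comment> \<open>For the rank-one effect of \<open>v\<close>, the trace of
        \<open>E ** G\<close> is the quadratic form of \<open>G\<close> at \<open>v\<close>.\<close>
      define E :: "complex^'b^'b" where "E = (\<chi> k l. v $ k * cnj (v $ l))"
      have "psd E"
        unfolding E_def by (rule psd_rank_one)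
      have "unnormalised_post \<rho> E $ i $ j = trace (unnormalised_post \<rho> E) * ptrace_B \<rho> $ i $ j"
        using eff[OF \<open>psd E\<close>] outcome_prob(1)[OF _ \<open>psd E\<close>, of \<rho>] assms(3)
        by (simp add: state_def scaleR_conv_of_real[where 'a = complex])
      moreover have "trace (unnormalised_post \<rho> E) = (\<Sum>k\<in>UNIV. \<Sum>l\<in>UNIV. E $ k $ l * ptrace_A \<rho> $ l $ k)"
        by (rule trace_unnormalised_post)
      ultimately have "(\<Sum>k\<in>UNIV. \<Sum>l\<in>UNIV. E $ k $ l * G $ l $ k) = 0"
        by (simp add: unnormalised_post_nth G_def sum_distrib_left sum_distrib_right right_diff_distrib
            sum_subtractf mult_ac)
      then show ?thesis
        unfolding cip_def matrix_vector_mult_def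
        by (subst (asm) sum.swap) (simp add: E_def sum_distrib_left mult_ac)
    qed
    then have "G = 0" by (rule zero_quadratic_form)
    then have "G $ l $ k = 0" by simp
    then show ?thesis by (simp add: G_def)
  qed
  then show ?thesis by (simp add: vec_eq_iff tensor_def)
qed

section \<open>Product states have vanishing correlation\<close>

lemma unnormalised_post_product:
  fixes \<rho> :: "complex^('a::finite \<times> 'b::finite)^('a \<times> 'b)"
  assumes "\<rho> = tensor A B"
  shows "unnormalised_post \<rho> E = (\<chi> i j. trace (E ** B) * A $ i $ j)"
  by (simp add: vec_eq_iff unnormalised_post_nth assms tensor_def trace_def matrix_matrix_mult_def
      sum_distrib_left sum_distrib_right mult_ac)

text \<open>Every outcome of nonzero probability leaves the reduced state on \<open>A\<close>. The
  probabilities sum to one, so the mean entropy equals the entropy of the mean.\<close>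

lemma measured_qjsd_product:
  fixes \<rho> :: "complex^('a::finite \<times> 'b::finite)^('a \<times> 'b)"
  assumes "state \<rho>" "povm n M" and prod: "\<rho> = tensor (ptrace_B \<rho>) (ptrace_A \<rho>)"
  shows "measured_qjsd \<alpha> \<rho> n M = 0"
proof -
  define K where "K = {x. x < n \<and> outcome_prob \<rho> (M x) \<noteq> 0}"
  note ens = measured_ensemble[OF assms(1,2), folded K_def]
  have tr: "trace (ptrace_B \<rho>) = 1"
    using assms(1) by (simp add: trace_ptrace_B state_def)
  have post: "post_state \<rho> (M x) = ptrace_B \<rho>" if "x \<in> K" for x
  proof -
    have psd: "psd \<rho>" "psd (M x)" and p: "outcome_prob \<rho> (M x) \<noteq> 0"
      using that assms by (auto simp: K_def state_def povm_def)
    note un = unnormalised_post_product[OF prod, of "M x"]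
    have "trace (unnormalised_post \<rho> (M x)) = trace (M x ** ptrace_A \<rho>) * trace (ptrace_B \<rho>)"
      unfolding un by (simp add: trace_def[of "ptrace_B \<rho>"] trace_def[of "vec_lambda _"] sum_distrib_left)
    then have "of_real (outcome_prob \<rho> (M x)) = trace (M x ** ptrace_A \<rho>)"
      using outcome_prob(1)[OF psd] tr by simp
    then show ?thesis
      using p unfolding post_state_def un
      by (simp add: vec_eq_iff scaleR_conv_of_real[where 'a = complex] flip: \<open>of_real _ = trace _\<close>)
  qed
  show ?thesis
    unfolding measured_qjsd_def K_def[symmetric] qjsd_def ens
    using ens(1) by (simp add: post flip: sum_distrib_right)
qed

theorem theorem15:
  fixes \<rho> :: "complex^('a::finite \<times> 'b::finite)^('a \<times> 'b)" and \<alpha> :: real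
  assumes "0 < \<alpha>" and "\<alpha> < 1"
    and "state \<rho>"
  shows "correlation \<alpha> \<rho> = 0 \<longleftrightarrow> \<rho> = tensor (ptrace_B \<rho>) (ptrace_A \<rho>)"
proof
  assume "correlation \<alpha> \<rho> = 0"
  then have "measured_qjsd \<alpha> \<rho> n M \<le> 0" if "povm n M" for n M
  proof -
    have "ereal (measured_qjsd \<alpha> \<rho> n M) \<le> correlation \<alpha> \<rho>"
      unfolding correlation_def using that by (intro Sup_upper) blast
    then show ?thesis using \<open>correlation \<alpha> \<rho> = 0\<close> by simp
  qed
  then show "\<rho> = tensor (ptrace_B \<rho>) (ptrace_A \<rho>)"
    using correlation_0_imp_product[OF assms] by blast
next
  assume prod: "\<rho> = tensor (ptrace_B \<rho>) (ptrace_A \<rho>)"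
  \<comment> \<open>The trivial measurement makes the set nonempty; the supremum of the empty set in
    \<open>ereal\<close> would be minus infinity rather than zero.\<close>
  have "povm 1 (\<lambda>_. mat 1 :: complex^'b^'b)"
    by (simp add: povm_def psd_mat_1)
  then have "{ereal (measured_qjsd \<alpha> \<rho> n M) | n M. povm n M} = {0}"
    using measured_qjsd_product[OF assms(3) _ prod] by fastforce
  then show "correlation \<alpha> \<rho> = 0"
    by (simp add: correlation_def)
qed

end
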